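(* Let $d\ge 1$ and $1\le r\le d$ be integers. Let $s$ range over a finite set of calibration sequences and, for each $s$, let $h$ range over a finite set of query heads. For each $s$ let $V_s\in\mathbb R^{T_s\times d}$, and for each $(s,h)$ let $\alpha_{s,h}\in\mathbb R^{T_s\times T_s}$ be a fixed (attention) matrix and $w_{s,h}\ge 0$ a fixed weight. For $P\in\mathbb R^{d\times r}$ with $P^\top P=I_r$ define $$D(P)=\sum_{s,h}w_{s,h}\,\bigl\|\alpha_{s,h}V_s(I-PP^\top)\bigr\|_F^2,$$ and define the $d\times d$ matrix $$M_V=\sum_{s,h}w_{s,h}\,V_s^\top\alpha_{s,h}^\top\alpha_{s,h}V_s .$$ Let $\lambda_1\ge\cdots\ge\lambda_d\ge 0$ be the eigenvalues of $M_V$, counted with multiplicity. Then any matrix $P\in\mathbb R^{d\times r}$ with $P^\top P=I_r$ whose columns span a top-$r$ eigenspace of $M_V$ minimizes $D$ over all $P\in\mathbb R^{d\times r}$ with $P^\top P=I_r$, and the minimum value is $$\min_{P^\top P=I_r}D(P)=\sum_{i=r+1}^d\lambda_i .$$ Moreover, the optimum need not be unique when eigenvalues tie: there are instances in which $M_V$ has repeated eigenvalues and the minimizing projector $PP^\top$ is not unique.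
   Context: $\|\cdot\|_F$ is the Frobenius norm, $I$ is the $d\times d$ identity and $I_r$ the $r\times r$ identity. $V_s$ is the matrix of value activations of sequence $s$ of length $T_s$ (one row per token), and $\alpha_{s,h}$ is the attention matrix of query head $h$ on sequence $s$; it is held fixed (it does not depend on $P$), and the setting specifies no property of it beyond being a fixed real $T_s\times T_s$ matrix. A "top-$r$ eigenspace" of the symmetric positive semidefinite matrix $M_V$ means the span of $r$ orthonormal eigenvectors of $M_V$ with eigenvalues $\lambda_1,\dots,\lambda_r$ (the $r$ largest, counted with multiplicity). *)

theory Defs
  imports "Jordan_Normal_Form.Char_Poly" "Jordan_Normal_Form.VS_Connect"
begin

definition frobenius_norm :: "real mat \<Rightarrow> real" where
  "frobenius_norm A = sqrt (\<Sum>i<dim_row A. \<Sum>j<dim_col A. (A $$ (i, j))\<^sup>2)"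

definition orthonormal_cols :: "nat \<Rightarrow> nat \<Rightarrow> real mat set" where
  "orthonormal_cols d r = {P \<in> carrier_mat d r. P\<^sup>T * P = 1\<^sub>m r}"

text \<open>The real roots of the characteristic polynomial with multiplicity, in decreasing order.
  Entries are numbered from 0, so \<open>eigvals A ! i\<close> is the mathematical \<open>\<lambda>\<close> with index \<open>i + 1\<close>.\<close>

definition eigvals :: "real mat \<Rightarrow> real list" where
  "eigvals A = rev (sorted_list_of_multiset (proots (char_poly A)))"

definition orthonormal_list :: "real vec list \<Rightarrow> bool" where
  "orthonormal_list us \<longleftrightarrow>
     (\<forall>i<length us. \<forall>j<length us. us ! i \<bullet> us ! j = (if i = j then 1 else 0))"

text \<open>With ties among the eigenvalues a matrix can have several top eigenspaces of
  the same dimension, hence a predicate on subspaces rather than a function.\<close>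

definition top_eigenspace :: "nat \<Rightarrow> nat \<Rightarrow> real mat \<Rightarrow> real vec set \<Rightarrow> bool" where
  "top_eigenspace d r A W \<longleftrightarrow>
     (\<exists>us. length us = r \<and> orthonormal_list us \<and>
        (\<forall>i<r. eigenvector A (us ! i) (eigvals A ! i)) \<and>
        W = LinearCombinations.module.span class_ring (module_vec TYPE(real) d) (set us))"

text \<open>\<open>S\<close>: sequences, \<open>H s\<close>: query heads on \<open>s\<close>, \<open>T s\<close>: length of \<open>s\<close>, \<open>V s\<close>: value activations,
  \<open>\<alpha> s h\<close>: attention matrices, \<open>w s h\<close>: weights.\<close>

definition calibration_data ::
  "nat \<Rightarrow> 's set \<Rightarrow> ('s \<Rightarrow> 'h set) \<Rightarrow> ('s \<Rightarrow> nat) \<Rightarrow> ('s \<Rightarrow> real mat) \<Rightarrow>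
   ('s \<Rightarrow> 'h \<Rightarrow> real mat) \<Rightarrow> ('s \<Rightarrow> 'h \<Rightarrow> real) \<Rightarrow> bool" where
  "calibration_data d S H T V \<alpha> w \<longleftrightarrow>
     finite S \<and>
     (\<forall>s\<in>S. finite (H s) \<and> V s \<in> carrier_mat (T s) d \<and>
        (\<forall>h\<in>H s. \<alpha> s h \<in> carrier_mat (T s) (T s) \<and> 0 \<le> w s h))"

definition distortion ::
  "nat \<Rightarrow> 's set \<Rightarrow> ('s \<Rightarrow> 'h set) \<Rightarrow> ('s \<Rightarrow> real mat) \<Rightarrow>
   ('s \<Rightarrow> 'h \<Rightarrow> real mat) \<Rightarrow> ('s \<Rightarrow> 'h \<Rightarrow> real) \<Rightarrow> real mat \<Rightarrow> real" where
  "distortion d S H V \<alpha> w P =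
     (\<Sum>s\<in>S. \<Sum>h\<in>H s. w s h * (frobenius_norm (\<alpha> s h * V s * (1\<^sub>m d - P * P\<^sup>T)))\<^sup>2)"

definition value_moment ::
  "nat \<Rightarrow> 's set \<Rightarrow> ('s \<Rightarrow> 'h set) \<Rightarrow> ('s \<Rightarrow> real mat) \<Rightarrow>
   ('s \<Rightarrow> 'h \<Rightarrow> real mat) \<Rightarrow> ('s \<Rightarrow> 'h \<Rightarrow> real) \<Rightarrow> real mat" where
  "value_moment d S H V \<alpha> w =
     mat d d (\<lambda>(i, j). \<Sum>s\<in>S. \<Sum>h\<in>H s.
       w s h * (((V s)\<^sup>T * (\<alpha> s h)\<^sup>T * \<alpha> s h * V s) $$ (i, j)))"

end

theory Submission
  imports Defs "Jordan_Normal_Form.Schur_Decomposition"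
begin

text \<open>Since \<open>I - P P\<^sup>T\<close> is a symmetric idempotent, cyclicity of the trace gives
  \<open>D P = tr M - tr (M P P\<^sup>T)\<close>, so the claim is Ky Fan's maximum principle for \<open>M\<close>. Diagonalise
  \<open>M\<close> by an orthogonal \<open>U\<close> and put \<open>Q = U\<^sup>T P P\<^sup>T U\<close>; then \<open>tr (M P P\<^sup>T)\<close> is the sum of the
  eigenvalues weighted by the diagonal of the projector \<open>Q\<close>. These weights lie in \<open>[0, 1]\<close> and sum
  to \<open>r\<close>, so the value is at most the sum of the \<open>r\<close> largest eigenvalues. It is attained
  when the columns of \<open>P\<close> span a top eigenspace, because \<open>P P\<^sup>T\<close> depends only on the column
  space. For \<open>M = I\<close> every \<open>P\<close> is optimal, hence the non-uniqueness.\<close>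

section \<open>The spectral theorem for real symmetric matrices\<close>

text \<open>A one-sided inverse of a square matrix over a field is two-sided.\<close>

lemma orthogonal_mult_transpose:
  fixes W :: "real mat"
  assumes "W \<in> carrier_mat n n" "W\<^sup>T * W = 1\<^sub>m n"
  shows "W * W\<^sup>T = 1\<^sub>m n"
  using assms by (intro mat_mult_left_right_inverse[of "W\<^sup>T" n W]) auto

text \<open>Pair an eigenvector \<open>v\<close> with its conjugate. As the matrix is real and
  symmetric, moving it across the product replaces \<open>a\<close> by \<open>cnj a\<close>, and the
  factor \<open>v \<bullet> conjugate v\<close> is nonzero.\<close>

lemma symmetric_eigenvalue_real:
  fixes A :: "real mat"
  assumes A: "A \<in> carrier_mat n n" and sym: "A\<^sup>T = A"
    and ev: "eigenvalue (map_mat complex_of_real A) a"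
  shows "a \<in> \<real>"
proof -
  let ?C = "map_mat complex_of_real A"
  have C: "?C \<in> carrier_mat n n" using A by auto
  have symC: "?C\<^sup>T = ?C" using sym by (metis map_mat_transpose)
  obtain v where v: "v \<in> carrier_vec n" "v \<noteq> 0\<^sub>v n" and Cv: "?C *\<^sub>v v = a \<cdot>\<^sub>v v"
    using ev C unfolding eigenvalue_def eigenvector_def by auto
  have cv: "conjugate v \<in> carrier_vec n" using v by auto
  have conj_Cv: "conjugate (?C *\<^sub>v v) = ?C *\<^sub>v conjugate v"
    using A v by (intro eq_vecI) (auto simp: scalar_prod_def intro!: sum.cong)
  have pos: "v \<bullet> conjugate v \<noteq> 0"
    using v by simp
  have "a * (v \<bullet> conjugate v) = (?C *\<^sub>v v) \<bullet> conjugate v"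
    using Cv v cv by simp
  also have "\<dots> = v \<bullet> (?C *\<^sub>v conjugate v)"
    using transpose_vec_mult_scalar[OF C cv v(1)] symC by simp
  also have "?C *\<^sub>v conjugate v = cnj a \<cdot>\<^sub>v conjugate v"
    using conj_Cv Cv by (simp add: conjugate_smult_vec)
  also have "v \<bullet> (cnj a \<cdot>\<^sub>v conjugate v) = cnj a * (v \<bullet> conjugate v)"
    using v cv by simp
  finally show ?thesis using pos by (simp add: Reals_cnj_iff)
qed

text \<open>The complex factorisation has only real roots, so it is the image of a real
  factorisation; the embedding of real into complex polynomials is injective.\<close>

lemma symmetric_char_poly_splits:
  fixes A :: "real mat"
  assumes A: "A \<in> carrier_mat n n" and sym: "A\<^sup>T = A"
  obtains es where "char_poly A = (\<Prod>e\<leftarrow>es. [:- e, 1:])" "length es = n"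
proof -
  let ?C = "map_mat complex_of_real A"
  have C: "?C \<in> carrier_mat n n" using A by auto
  obtain as where as: "char_poly ?C = (\<Prod>a\<leftarrow>as. [:- a, 1:])" "length as = n"
    using char_poly_factorized[OF C] by blast
  have "a \<in> \<real>" if "a \<in> set as" for a
  proof -
    have "poly (char_poly ?C) a = 0"
      using that unfolding as(1) by (induction as) auto
    then show ?thesis
      using symmetric_eigenvalue_real[OF A sym] eigenvalue_root_char_poly[OF C] by blast
  qed
  then have as_eq: "as = map complex_of_real (map Re as)"
    by (auto intro!: map_idI[symmetric])
  interpret h: map_poly_inj_idom_hom complex_of_real ..
  have "map_poly complex_of_real (\<Prod>e\<leftarrow>es. [:- e, 1:])
      = (\<Prod>a\<leftarrow>map complex_of_real es. [:- a, 1:])" for es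
    by (induction es) (simp_all add: h.hom_mult del: mult_pCons_left mult_pCons_right)
  from this[of "map Re as"] have "map_poly complex_of_real (\<Prod>e\<leftarrow>map Re as. [:- e, 1:])
      = map_poly complex_of_real (char_poly A)"
    unfolding as_eq[symmetric] as(1)[symmetric] by (simp add: of_real_hom.char_poly_hom[OF A])
  then show ?thesis using that[of "map Re as"] as(2) by simp
qed

text \<open>Because \<open>eigvals\<close> collects real roots only, it can be too short for a
  general matrix. Splitting over the reals guarantees that it lists all \<open>n\<close>
  eigenvalues.\<close>

lemma eigvals_symmetric:
  fixes A :: "real mat"
  assumes A: "A \<in> carrier_mat n n" and sym: "A\<^sup>T = A"
  shows "char_poly A = (\<Prod>e\<leftarrow>eigvals A. [:- e, 1:])" "length (eigvals A) = n"
proof -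
  obtain es where es: "char_poly A = (\<Prod>e\<leftarrow>es. [:- e, 1:])" "length es = n"
    using symmetric_char_poly_splits[OF A sym] .
  have "proots (\<Prod>e\<leftarrow>xs. [:- e, 1:]) = mset xs" for xs :: "real list"
  proof (induction xs)
    case (Cons x xs)
    have "(\<Prod>e\<leftarrow>xs. [:- e, 1:]) \<noteq> 0"
      by (auto simp: prod_list_zero_iff)
    with Cons show ?case by (simp add: proots_mult del: mult_pCons_left)
  qed simp
  then have m: "mset (eigvals A) = mset es"
    by (simp add: eigvals_def es(1))
  then show "length (eigvals A) = n"
    using es(2) mset_eq_length by metis
  \<comment> \<open>The product depends only on the multiset of roots, so sorting them is
    harmless.\<close>
  have "(\<Prod>e\<leftarrow>xs. [:- e, 1:]) = prod_mset (image_mset (\<lambda>e. [:- e, 1:]) (mset xs))"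
    for xs :: "real list"
    by (metis mset_map prod_mset_prod_list)
  with m es(1) show "char_poly A = (\<Prod>e\<leftarrow>eigvals A. [:- e, 1:])" by simp
qed

lemma sorted_wrt_eigvals: "sorted_wrt (\<ge>) (eigvals A)"
  unfolding eigvals_def sorted_wrt_rev by simp

section \<open>Diagonalisation by deflation\<close>

text \<open>Complete \<open>v\<close> to a basis and run Gram-Schmidt, which leaves the first vector
  unchanged. Normalising then rescales it, so column 0 is only a multiple of \<open>v\<close>; that
  is enough when \<open>v\<close> is an eigenvector.\<close>

lemma orthonormal_basis_extension:
  fixes v :: "real vec"
  assumes v: "v \<in> carrier_vec n" "v \<noteq> 0\<^sub>v n"
  obtains W c where "W \<in> carrier_mat n n" "W\<^sup>T * W = 1\<^sub>m n" "c \<noteq> 0" "col W 0 = c \<cdot>\<^sub>v v"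
proof -
  interpret cof_vec_space n "TYPE(real)" .
  define b where "b = basis_completion v"
  define ws where "ws = gram_schmidt n b"
  note b = basis_completion[OF v, folded b_def]
  note gs = gram_schmidt_result[OF b(2) b(4) b(5) ws_def]
  have n: "n \<noteq> 0" using v by (auto intro!: eq_vecI)
  have len: "length ws = n" using gs(4) b(6) by simp
  from b(6,7) n obtain vs where "b = v # vs" by (cases b) auto
  then have hd: "ws ! 0 = v"
    using gram_schmidt_hd[OF v(1), of vs] len n unfolding ws_def by (metis hd_conv_nth length_0_conv)
  have wsc: "ws ! i \<in> carrier_vec n" if "i < n" for i
    using gs(3) len that by auto
  define c where "c i = 1 / sqrt (ws ! i \<bullet> ws ! i)" for i
  have orth: "ws ! i \<bullet> ws ! j = 0 \<longleftrightarrow> i \<noteq> j" if "i < n" "j < n" for i j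
    using corthogonalD[OF gs(2), of i j] that len by simp
  \<comment> \<open>\<open>orth\<close> with equal indices already excludes the value 0, so
    nonnegativity suffices.\<close>
  have pos: "ws ! i \<bullet> ws ! i > 0" if "i < n" for i
  proof -
    have "ws ! i \<bullet>c ws ! i \<ge> 0" by (rule conjugate_square_ge_0_vec)
    with orth[OF that that] show ?thesis by simp
  qed
  define W where "W = mat_of_cols n (map (\<lambda>i. c i \<cdot>\<^sub>v ws ! i) [0..<n])"
  have W: "W \<in> carrier_mat n n" unfolding W_def by (rule carrier_matI) simp_all
  have col: "col W i = c i \<cdot>\<^sub>v ws ! i" if "i < n" for i
    unfolding W_def using that wsc by (subst col_mat_of_cols) auto
  have "W\<^sup>T * W = 1\<^sub>m n"
  proof (rule eq_matI)
    fix i j assume "i < dim_row (1\<^sub>m n :: real mat)" "j < dim_col (1\<^sub>m n :: real mat)"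
    then have ij: "i < n" "j < n" by auto
    have "(W\<^sup>T * W) $$ (i, j) = c i * c j * (ws ! i \<bullet> ws ! j)"
      using W ij wsc[OF ij(1)] wsc[OF ij(2)]
      by (simp add: col smult_scalar_prod_distrib[of _ n] scalar_prod_smult_distrib[of _ n])
    also have "\<dots> = (if i = j then 1 else 0)"
      using orth[OF ij] pos[OF ij(1)] by (auto simp: c_def)
    finally show "(W\<^sup>T * W) $$ (i, j) = 1\<^sub>m n $$ (i, j)"
      using ij by simp
  qed (use W in auto)
  moreover have "c 0 \<noteq> 0" using pos[of 0] n by (simp add: c_def)
  ultimately show ?thesis using that[of W "c 0"] W col[of 0] n hd by auto
qed

text \<open>Reassembles the diagonal after deflation: the eigenvalue split off becomes entry 0 and
  the remaining ones shift by one.\<close>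

lemma four_block_mat_diag_cons:
  "four_block_mat (mat 1 1 (\<lambda>_. e)) (0\<^sub>m 1 m) (0\<^sub>m m 1) (mat_diag m (\<lambda>i. es ! i)) =
     mat_diag (Suc m) (\<lambda>i. (e # es) ! i)"
  by (rule eq_matI) (auto simp: mat_diag_def nth_Cons split: nat.splits)

text \<open>Induction on the list of roots. An orthogonal change of basis puts an eigenvector for
  the head \<open>e\<close> first; symmetry then clears the first row along with the first column,
  and the remaining symmetric block has the tail as its roots. The order of \<open>es\<close> is
  free, so the diagonal can later be taken decreasing.\<close>

theorem real_symmetric_spectral:
  fixes A :: "real mat"
  assumes "A \<in> carrier_mat n n" "A\<^sup>T = A" "char_poly A = (\<Prod>e\<leftarrow>es. [:- e, 1:])"
  obtains U where "U \<in> carrier_mat n n" "U\<^sup>T * U = 1\<^sub>m n"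
    "U\<^sup>T * A * U = mat_diag n (\<lambda>i. es ! i)"
proof -
  have "\<exists>U\<in>carrier_mat n n. U\<^sup>T * U = 1\<^sub>m n \<and> U\<^sup>T * A * U = mat_diag n (\<lambda>i. es ! i)"
    using assms
  proof (induction es arbitrary: n A)
    case Nil
    then have "n = 0" using degree_monic_char_poly[of A n] by auto
    then show ?case using Nil by (intro bexI[of _ "1\<^sub>m 0"]) (auto simp: mat_diag_def)
  next
    case (Cons e es)
    note A = Cons.prems(1) and sym = Cons.prems(2)
    have "eigenvalue A e"
      unfolding eigenvalue_root_char_poly[OF A] Cons.prems(3) by simp
    then obtain v where v: "v \<in> carrier_vec n" "v \<noteq> 0\<^sub>v n" and Av: "A *\<^sub>v v = e \<cdot>\<^sub>v v"
      using A unfolding eigenvalue_def eigenvector_def by auto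
    have "n \<noteq> 0" using v by (auto intro!: eq_vecI)
    then obtain m where n: "n = Suc m" by (cases n) auto
    obtain W c where W: "W \<in> carrier_mat n n" "W\<^sup>T * W = 1\<^sub>m n" and c: "c \<noteq> 0" "col W 0 = c \<cdot>\<^sub>v v"
      using orthonormal_basis_extension[OF v] .
    note WW = orthogonal_mult_transpose[OF W]
    define B where "B = W\<^sup>T * A * W"
    have B: "B \<in> carrier_mat n n" using W A by (auto simp: B_def)
    have symB: "B\<^sup>T = B"
      unfolding B_def using W A sym
      by (simp add: transpose_mult[of _ n n _ n] assoc_mult_mat[of _ n n _ n _ n])
    have Acol: "A *\<^sub>v col W 0 = e \<cdot>\<^sub>v col W 0"
      using A v Av by (simp add: c(2) mult_mat_vec smult_smult_assoc mult.commute)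
    have B0: "B $$ (i, 0) = (if i = 0 then e else 0)" if i: "i < n" for i
    proof -
      have "B $$ (i, 0) = (W\<^sup>T * (A * W)) $$ (i, 0)"
        unfolding B_def using W A by (simp add: assoc_mult_mat[of _ n n _ n _ n])
      also have "\<dots> = row W\<^sup>T i \<bullet> col (A * W) 0"
        using W A i n by (intro index_mult_mat) auto
      also have "col (A * W) 0 = e \<cdot>\<^sub>v col W 0"
        using col_mult2[OF A W(1), of 0] n Acol by simp
      also have "row W\<^sup>T i \<bullet> (e \<cdot>\<^sub>v col W 0) = e * (W\<^sup>T * W) $$ (i, 0)"
        using W(1) i n by simp
      finally show ?thesis unfolding W(2) using i n by simp
    qed
    have B0': "B $$ (0, i) = (if i = 0 then e else 0)" if i: "i < n" for i
      using B0[OF i] symB B i n by (metis carrier_matD index_transpose_mat(1) zero_less_Suc)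
    define C where "C = mat m m (\<lambda>(i, j). B $$ (Suc i, Suc j))"
    have C: "C \<in> carrier_mat m m" by (simp add: C_def)
    have symC: "C\<^sup>T = C"
    proof (rule eq_matI)
      fix i j assume "i < dim_row C" "j < dim_col C"
      then have "i < m" "j < m" by (auto simp: C_def)
      then show "C\<^sup>T $$ (i, j) = C $$ (i, j)"
        using arg_cong[OF symB, of "\<lambda>X. X $$ (Suc i, Suc j)"] B n by (simp add: C_def)
    qed (auto simp: C_def)
    let ?e = "mat 1 1 (\<lambda>_. e)"
    have B_block: "B = four_block_mat ?e (0\<^sub>m 1 m) (0\<^sub>m m 1) C"
      using B B0 B0' n by (intro eq_matI) (auto simp: C_def)
    \<comment> \<open>Similarity preserves the characteristic polynomial; cancelling the factor of
      the block \<open>e\<close> leaves the polynomial of \<open>C\<close>, as the induction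
      hypothesis requires.\<close>
    have "similar_mat_wit B A W\<^sup>T W"
      using W WW A B by (intro similar_mat_witI[of _ _ n]) (auto simp: B_def)
    then have "char_poly B = [:- e, 1:] * (\<Prod>e\<leftarrow>es. [:- e, 1:])"
      using char_poly_similar[of B A] Cons.prems(3) by (auto simp: similar_mat_def)
    also have "char_poly B = char_poly ?e * char_poly C"
      unfolding B_block by (rule char_poly_four_block_zeros_col) (use C in auto)
    also have "char_poly ?e = [:- e, 1:]"
      by (simp add: char_poly_defs det_def sign_def)
    finally have "char_poly C = (\<Prod>e\<leftarrow>es. [:- e, 1:])"
      by (metis mult_cancel_left pCons_eq_0_iff zero_neq_one)
    from Cons.IH[OF C symC this] obtain X where X: "X \<in> carrier_mat m m" "X\<^sup>T * X = 1\<^sub>m m"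
      and XCX: "X\<^sup>T * C * X = mat_diag m (\<lambda>i. es ! i)" by auto
    \<comment> \<open>The change of basis for \<open>C\<close>, extended by the identity on the
      first coordinate. The required orthogonal matrix is \<open>W * Y\<close>.\<close>
    define Y where "Y = four_block_mat (1\<^sub>m 1) (0\<^sub>m 1 m) (0\<^sub>m m 1) X"
    have Y: "Y \<in> carrier_mat n n" using X n by (auto simp: Y_def)
    have YT: "Y\<^sup>T = four_block_mat (1\<^sub>m 1) (0\<^sub>m 1 m) (0\<^sub>m m 1) X\<^sup>T"
      unfolding Y_def using X by (subst transpose_four_block_mat[of _ 1 1 _ m _ m]) auto
    have YY: "Y\<^sup>T * Y = 1\<^sub>m n"
      unfolding YT unfolding Y_def using X n
      by (subst mult_four_block_mat[of _ 1 1 _ m _ m _ _ 1 _ m]) auto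
    have "Y\<^sup>T * B = four_block_mat ?e (0\<^sub>m 1 m) (0\<^sub>m m 1) (X\<^sup>T * C)"
      unfolding YT B_block using X C
      by (subst mult_four_block_mat[of _ 1 1 _ m _ m _ _ 1 _ m]) auto
    also have "\<dots> * Y = four_block_mat ?e (0\<^sub>m 1 m) (0\<^sub>m m 1) (X\<^sup>T * C * X)"
      unfolding Y_def using X C
      by (subst mult_four_block_mat[of _ 1 1 _ m _ m _ _ 1 _ m]) auto
    finally have YBY: "Y\<^sup>T * B * Y = mat_diag n (\<lambda>i. (e # es) ! i)"
      unfolding XCX four_block_mat_diag_cons n .
    have "(W * Y)\<^sup>T * (W * Y) = Y\<^sup>T * (W\<^sup>T * W) * Y"
      using W(1) Y by (simp add: transpose_mult[of _ n n _ n] assoc_mult_mat[of _ n n _ n _ n])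
    then have 1: "(W * Y)\<^sup>T * (W * Y) = 1\<^sub>m n"
      using W Y YY by simp
    have "(W * Y)\<^sup>T * A * (W * Y) = Y\<^sup>T * B * Y"
      unfolding B_def
      using W(1) Y A by (simp add: transpose_mult[of _ n n _ n] assoc_mult_mat[of _ n n _ n _ n])
    with 1 YBY W Y show ?case by (intro bexI[of _ "W * Y"]) auto
  qed
  then show ?thesis using that by blast
qed

section \<open>Traces and Ky Fan's maximum principle\<close>

definition mat_trace :: "real mat \<Rightarrow> real" where
  "mat_trace A = (\<Sum>i<dim_row A. A $$ (i, i))"

lemma index_mult_mat_sum:
  assumes "A \<in> carrier_mat n m" "B \<in> carrier_mat m k" "i < n" "j < k"
  shows "(A * B) $$ (i, j) = (\<Sum>l<m. A $$ (i, l) * B $$ (l, j))"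
  using assms by (simp add: scalar_prod_def atLeast0LessThan)

lemma mat_trace_mult:
  assumes "A \<in> carrier_mat n m" "B \<in> carrier_mat m n"
  shows "mat_trace (A * B) = (\<Sum>i<n. \<Sum>j<m. A $$ (i, j) * B $$ (j, i))"
  using assms unfolding mat_trace_def
  by (auto intro!: sum.cong simp del: index_mult_mat(1) simp add: index_mult_mat_sum)

lemma mat_trace_mult_commute:
  assumes "A \<in> carrier_mat n m" "B \<in> carrier_mat m n"
  shows "mat_trace (A * B) = mat_trace (B * A)"
  unfolding mat_trace_mult[OF assms] mat_trace_mult[OF assms(2,1)]
  by (subst sum.swap) (simp add: mult.commute)

lemma mat_trace_diff:
  assumes "A \<in> carrier_mat n n" "B \<in> carrier_mat n n"
  shows "mat_trace (A - B) = mat_trace A - mat_trace B"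
  using assms by (simp add: mat_trace_def sum_subtractf)

lemma mat_trace_one: "mat_trace (1\<^sub>m n) = n"
  by (simp add: mat_trace_def)

lemma mat_trace_mat_diag: "mat_trace (mat_diag n f) = (\<Sum>i<n. f i)"
  by (simp add: mat_trace_def mat_diag_def)

lemma mat_trace_mat_diag_mult:
  assumes "A \<in> carrier_mat n n"
  shows "mat_trace (mat_diag n f * A) = (\<Sum>i<n. f i * A $$ (i, i))"
  unfolding mat_diag_mult_left[OF assms] by (simp add: mat_trace_def)

lemma frobenius_norm_sq:
  assumes "A \<in> carrier_mat n m"
  shows "(frobenius_norm A)\<^sup>2 = mat_trace (A\<^sup>T * A)"
proof -
  have "(frobenius_norm A)\<^sup>2 = (\<Sum>i<n. \<Sum>j<m. (A $$ (i, j))\<^sup>2)"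
    using assms unfolding frobenius_norm_def by (subst real_sqrt_pow2) (auto intro!: sum_nonneg)
  also have "\<dots> = (\<Sum>j<m. \<Sum>i<n. A\<^sup>T $$ (j, i) * A $$ (i, j))"
    using assms by (subst sum.swap) (auto intro!: sum.cong simp: power2_eq_square)
  finally show ?thesis
    using assms by (simp add: mat_trace_mult[of _ m n])
qed

section \<open>Bounded weights and diagonals of projectors\<close>

lemma sum_mult_le_sum_initial:
  fixes f q :: "nat \<Rightarrow> real"
  assumes r: "1 \<le> r" "r \<le> d"
    and anti: "\<And>i j. i \<le> j \<Longrightarrow> j < d \<Longrightarrow> f j \<le> f i"
    and q: "\<And>i. i < d \<Longrightarrow> 0 \<le> q i" "\<And>i. i < d \<Longrightarrow> q i \<le> 1"
    and sum_q: "(\<Sum>i<d. q i) = real r"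
  shows "(\<Sum>i<d. f i * q i) \<le> (\<Sum>i<r. f i)"
proof -
  \<comment> \<open>The constant between the two groups makes both sums below of definite sign.\<close>
  define c where "c = f (r - 1)"
  have split: "(\<Sum>i<d. g i) = (\<Sum>i<r. g i) + (\<Sum>i=r..<d. g i)" for g :: "nat \<Rightarrow> real"
    using r sum.atLeastLessThan_concat[of 0 r d g] by (simp add: atLeast0LessThan)
  have "(\<Sum>i<r. (f i - c) * (1 - q i)) \<ge> 0"
    using r anti q by (intro sum_nonneg mult_nonneg_nonneg) (auto simp: c_def)
  moreover have "(\<Sum>i=r..<d. (f i - c) * q i) \<le> 0"
    using r anti q by (intro sum_nonpos mult_nonpos_nonneg) (auto simp: c_def)
  \<comment> \<open>The last summand collects the contributions of \<open>c\<close>; it vanishes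
    because the weights sum to \<open>r\<close>.\<close>
  moreover have "(\<Sum>i<r. f i) - (\<Sum>i<d. f i * q i) =
      (\<Sum>i<r. (f i - c) * (1 - q i)) - (\<Sum>i=r..<d. (f i - c) * q i)
      + c * (real r - (\<Sum>i<d. q i))"
    unfolding split[of "\<lambda>i. f i * q i"] split[of q]
    by (simp add: algebra_simps sum.distrib sum_subtractf sum_distrib_left)
  ultimately show ?thesis using sum_q by simp
qed

text \<open>From \<open>Q = Q * Q\<^sup>T\<close>, a diagonal entry is the sum of the squares of its
  row. This sum contains the square of the entry itself, and a real number that is at least its own
  square lies in the unit interval.\<close>

lemma symmetric_idempotent_diag_bounds:
  fixes Q :: "real mat"
  assumes Q: "Q \<in> carrier_mat n n" "Q\<^sup>T = Q" "Q * Q = Q" and i: "i < n"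
  shows "0 \<le> Q $$ (i, i)" "Q $$ (i, i) \<le> 1"
proof -
  have "Q $$ (i, i) = (Q * Q\<^sup>T) $$ (i, i)" using Q by simp
  also have "\<dots> = (\<Sum>j<n. (Q $$ (i, j))\<^sup>2)"
    using Q(1) i by (subst index_mult_mat_sum[of _ n n _ n]) (auto simp: power2_eq_square)
  finally have eq: "Q $$ (i, i) = (\<Sum>j<n. (Q $$ (i, j))\<^sup>2)" .
  then show ge: "0 \<le> Q $$ (i, i)" by (simp add: sum_nonneg)
  have "(Q $$ (i, i))\<^sup>2 \<le> (\<Sum>j<n. (Q $$ (i, j))\<^sup>2)"
    using i by (intro member_le_sum) auto
  with eq have "Q $$ (i, i) * Q $$ (i, i) \<le> Q $$ (i, i) * 1"
    by (simp add: power2_eq_square)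
  with ge show "Q $$ (i, i) \<le> 1"
    using mult_le_cancel_left_pos[of "Q $$ (i, i)" "Q $$ (i, i)" 1] by linarith
qed

lemma orthonormal_colsD:
  assumes "P \<in> orthonormal_cols d r"
  shows "P \<in> carrier_mat d r" "P\<^sup>T * P = 1\<^sub>m r"
  using assms by (auto simp: orthonormal_cols_def)

lemma orthonormal_cols_projector:
  assumes "P \<in> orthonormal_cols d r"
  shows "P * P\<^sup>T \<in> carrier_mat d d" "(P * P\<^sup>T)\<^sup>T = P * P\<^sup>T" "(P * P\<^sup>T) * (P * P\<^sup>T) = P * P\<^sup>T"
    "mat_trace (P * P\<^sup>T) = r"
proof -
  note P = orthonormal_colsD[OF assms]
  show "P * P\<^sup>T \<in> carrier_mat d d" using P by auto
  show "(P * P\<^sup>T)\<^sup>T = P * P\<^sup>T" using P by (simp add: transpose_mult[of _ d r _ d])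
  have "(P * P\<^sup>T) * (P * P\<^sup>T) = P * ((P\<^sup>T * P) * P\<^sup>T)"
    using P(1) by (simp add: assoc_mult_mat[of _ d r _ d _ d] assoc_mult_mat[of _ r d _ r _ d])
  then show "(P * P\<^sup>T) * (P * P\<^sup>T) = P * P\<^sup>T"
    unfolding P(2) using P(1) by simp
  show "mat_trace (P * P\<^sup>T) = r"
    using P mat_trace_mult_commute[of P d r "P\<^sup>T"] by (simp add: mat_trace_one)
qed

theorem ky_fan_upper_bound:
  fixes M :: "real mat"
  assumes M: "M \<in> carrier_mat d d" "M\<^sup>T = M" and r: "1 \<le> r" "r \<le> d"
    and P: "P \<in> orthonormal_cols d r"
  shows "mat_trace (M * (P * P\<^sup>T)) \<le> (\<Sum>i<r. eigvals M ! i)"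
proof -
  note eig = eigvals_symmetric[OF M]
  obtain U where U: "U \<in> carrier_mat d d" "U\<^sup>T * U = 1\<^sub>m d"
    and UMU: "U\<^sup>T * M * U = mat_diag d (\<lambda>i. eigvals M ! i)"
    using real_symmetric_spectral[OF M eig(1)] .
  note UU = orthogonal_mult_transpose[OF U]
  note Pi = orthonormal_cols_projector[OF P]
  define S where "S = P * P\<^sup>T"
  define Q where "Q = U\<^sup>T * S * U"
  note S = Pi[folded S_def]
  note assoc = assoc_mult_mat[of _ d d _ d _ d]
  \<comment> \<open>With all products nested to the right, this is the form in which the changes of
    basis cancel below.\<close>
  have cancel: "U * (U\<^sup>T * X) = X" if "X \<in> carrier_mat d d" for X
    using that U(1) UU by (simp add: assoc[symmetric])
  have Q: "Q \<in> carrier_mat d d" using U S by (simp add: Q_def)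
  have symQ: "Q\<^sup>T = Q"
    unfolding Q_def using U(1) S(1,2) by (simp add: transpose_mult[of _ d d _ d] assoc)
  have "Q * Q = U\<^sup>T * ((S * S) * U)"
    unfolding Q_def using U(1) S(1) by (simp add: assoc cancel)
  then have idQ: "Q * Q = Q"
    unfolding S(3) Q_def using U(1) S(1) by (simp add: assoc)
  have trQ: "mat_trace Q = r"
    unfolding Q_def using mat_trace_mult_commute[of "U\<^sup>T * S" d d U] U(1) S(1,4)
    by (simp add: cancel)
  have MS: "(U\<^sup>T * M * U) * Q = U\<^sup>T * (M * S * U)"
    unfolding Q_def using U(1) S(1) M(1) by (simp add: assoc cancel)
  \<comment> \<open>Inserting \<open>U * U\<^sup>T\<close> and using cyclicity expresses the trace
    in the eigenbasis, where only the diagonal of \<open>Q\<close> matters.\<close>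
  have "mat_trace (M * S) = mat_trace ((M * S * U) * U\<^sup>T)"
    using U(1) UU M(1) S(1) by (simp add: assoc)
  also have "\<dots> = mat_trace (U\<^sup>T * (M * S * U))"
    using U(1) M(1) S(1) by (intro mat_trace_mult_commute[of _ d d]) auto
  also have "\<dots> = (\<Sum>i<d. eigvals M ! i * Q $$ (i, i))"
    unfolding MS[symmetric] UMU by (rule mat_trace_mat_diag_mult[OF Q])
  also have "\<dots> \<le> (\<Sum>i<r. eigvals M ! i)"
  proof (rule sum_mult_le_sum_initial[OF r])
    fix i j assume "i \<le> j" "j < d"
    then show "eigvals M ! j \<le> eigvals M ! i"
      using sorted_wrt_eigvals[of M] eig(2)
      by (cases "i = j") (auto simp: sorted_wrt_iff_nth_less)
  next
    show "(\<Sum>i<d. Q $$ (i, i)) = real r"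
      using trQ Q by (simp add: mat_trace_def)
  qed (use symmetric_idempotent_diag_bounds[OF Q symQ idQ] in auto)
  finally show ?thesis unfolding S_def .
qed

lemma mat_trace_symmetric:
  fixes M :: "real mat"
  assumes M: "M \<in> carrier_mat d d" "M\<^sup>T = M"
  shows "mat_trace M = (\<Sum>i<d. eigvals M ! i)"
proof -
  obtain U where U: "U \<in> carrier_mat d d" "U\<^sup>T * U = 1\<^sub>m d"
    and UMU: "U\<^sup>T * M * U = mat_diag d (\<lambda>i. eigvals M ! i)"
    using real_symmetric_spectral[OF M eigvals_symmetric(1)[OF M]] .
  have "mat_trace M = mat_trace (M * U * U\<^sup>T)"
    using U(1) orthogonal_mult_transpose[OF U] M(1) by (simp add: assoc_mult_mat[of _ d d _ d _ d])
  also have "\<dots> = mat_trace (U\<^sup>T * M * U)"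
    using U(1) M(1) mat_trace_mult_commute[of "M * U" d d "U\<^sup>T"]
    by (simp add: assoc_mult_mat[of _ d d _ d _ d])
  finally show ?thesis unfolding UMU mat_trace_mat_diag .
qed

section \<open>Distortion and the value moment\<close>

lemma value_moment_carrier: "value_moment d S H V \<alpha> w \<in> carrier_mat d d"
  by (simp add: value_moment_def)

text \<open>Each summand of the value moment is a Gram matrix. Both its symmetry and its link to the
  Frobenius norm come from this form.\<close>

lemma gram_eq:
  fixes V :: "real mat"
  assumes "V \<in> carrier_mat n d" "B \<in> carrier_mat n n"
  shows "V\<^sup>T * B\<^sup>T * B * V = (B * V)\<^sup>T * (B * V)"
  using assms
  by (simp add: transpose_mult[of _ n n _ d] assoc_mult_mat[of _ d n _ n _ n]
      assoc_mult_mat[of _ d n _ n _ d] assoc_mult_mat[of _ n n _ n _ d])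

lemma value_moment_symmetric:
  assumes "calibration_data d S H T V \<alpha> w"
  shows "(value_moment d S H V \<alpha> w)\<^sup>T = value_moment d S H V \<alpha> w"
proof -
  have "((V s)\<^sup>T * (\<alpha> s h)\<^sup>T * \<alpha> s h * V s) $$ (i, j) = ((V s)\<^sup>T * (\<alpha> s h)\<^sup>T * \<alpha> s h * V s) $$ (j, i)"
    if "s \<in> S" "h \<in> H s" "i < d" "j < d" for s h i j
  proof -
    have c: "V s \<in> carrier_mat (T s) d" "\<alpha> s h \<in> carrier_mat (T s) (T s)"
      using assms that by (auto simp: calibration_data_def)
    define B where "B = \<alpha> s h * V s"
    have "B \<in> carrier_mat (T s) d" using c by (simp add: B_def)
    then show ?thesis
      unfolding gram_eq[OF c] B_def[symmetric] using that
      by (simp add: comm_scalar_prod[of "col B i" "T s"])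
  qed
  then show ?thesis
    by (intro eq_matI) (auto simp: value_moment_def intro!: sum.cong)
qed

text \<open>For each head, cyclicity turns the squared norm into the trace of a Gram matrix against
  \<open>X * X\<^sup>T\<close>; linearity does the rest. The matrix \<open>X\<close> is left general
  for two uses: the complementary projector yields the distortion, and a rank-one matrix yields the
  sign of an eigenvalue.\<close>

lemma mat_trace_value_moment:
  assumes data: "calibration_data d S H T V \<alpha> w" and X: "X \<in> carrier_mat d k"
  shows "mat_trace (value_moment d S H V \<alpha> w * (X * X\<^sup>T)) =
    (\<Sum>s\<in>S. \<Sum>h\<in>H s. w s h * (frobenius_norm (\<alpha> s h * V s * X))\<^sup>2)"
proof -
  let ?G = "\<lambda>s h. (V s)\<^sup>T * (\<alpha> s h)\<^sup>T * \<alpha> s h * V s"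
  have XX: "X * X\<^sup>T \<in> carrier_mat d d" using X by simp
  have norm: "(\<Sum>i<d. \<Sum>j<d. ?G s h $$ (i, j) * (X * X\<^sup>T) $$ (j, i))
      = (frobenius_norm (\<alpha> s h * V s * X))\<^sup>2" if "s \<in> S" "h \<in> H s" for s h
  proof -
    have c: "V s \<in> carrier_mat (T s) d" "\<alpha> s h \<in> carrier_mat (T s) (T s)"
      using data that by (auto simp: calibration_data_def)
    define B where "B = \<alpha> s h * V s"
    have B: "B \<in> carrier_mat (T s) d" using c by (simp add: B_def)
    have "(frobenius_norm (B * X))\<^sup>2 = mat_trace ((B * X)\<^sup>T * (B * X))"
      using B X by (intro frobenius_norm_sq[of _ "T s" k]) simp
    also have "\<dots> = mat_trace ((B * X) * (B * X)\<^sup>T)"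
      using B X by (intro mat_trace_mult_commute[of _ k "T s"]) auto
    also have "(B * X) * (B * X)\<^sup>T = B * (X * X\<^sup>T * B\<^sup>T)"
      using B X by (simp add: transpose_mult[of _ "T s" d _ k] assoc_mult_mat[of _ "T s" d _ k _ "T s"]
          assoc_mult_mat[of _ d k _ d _ "T s"])
    also have "mat_trace \<dots> = mat_trace ((X * X\<^sup>T * B\<^sup>T) * B)"
      using B XX by (intro mat_trace_mult_commute[of _ "T s" d]) auto
    also have "\<dots> = mat_trace ((X * X\<^sup>T) * (B\<^sup>T * B))"
      using B XX by (simp add: assoc_mult_mat[of _ d d _ "T s" _ d])
    also have "\<dots> = mat_trace ((B\<^sup>T * B) * (X * X\<^sup>T))"
      using B XX by (intro mat_trace_mult_commute[of _ d d]) auto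
    also have "\<dots> = (\<Sum>i<d. \<Sum>j<d. (B\<^sup>T * B) $$ (i, j) * (X * X\<^sup>T) $$ (j, i))"
      using B XX by (intro mat_trace_mult) auto
    finally show ?thesis unfolding gram_eq[OF c] B_def ..
  qed
  have "mat_trace (value_moment d S H V \<alpha> w * (X * X\<^sup>T)) =
      (\<Sum>i<d. \<Sum>j<d. (\<Sum>s\<in>S. \<Sum>h\<in>H s. w s h * ?G s h $$ (i, j)) * (X * X\<^sup>T) $$ (j, i))"
    unfolding mat_trace_mult[OF value_moment_carrier XX] by (simp add: value_moment_def)
  \<comment> \<open>Only the order of the four sums changes; as \<open>H s\<close> depends on
    \<open>s\<close>, the sum over \<open>h\<close> stays inside the sum over
    \<open>s\<close>.\<close>
  also have "\<dots> = (\<Sum>s\<in>S. \<Sum>h\<in>H s. \<Sum>i<d. \<Sum>j<d. w s h * ?G s h $$ (i, j) * (X * X\<^sup>T) $$ (j, i))"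
    unfolding sum_distrib_right
    by (subst (3) sum.swap, subst sum.swap)
       (rule sum.cong[OF refl], subst (2) sum.swap, subst sum.swap, rule refl)
  also have "\<dots> = (\<Sum>s\<in>S. \<Sum>h\<in>H s. w s h * (frobenius_norm (\<alpha> s h * V s * X))\<^sup>2)"
    by (intro sum.cong refl) (simp only: norm[symmetric] sum_distrib_left mult.assoc)
  finally show ?thesis .
qed

text \<open>An eigenvalue is the trace of \<open>M\<close> against the rank-one projector onto its
  eigenvector, hence a nonnegatively weighted sum of squared norms.\<close>

lemma eigvals_value_moment_nonneg:
  assumes data: "calibration_data d S H T V \<alpha> w" and x: "x \<in> set (eigvals (value_moment d S H V \<alpha> w))"
  shows "0 \<le> x"
proof -
  define M where "M = value_moment d S H V \<alpha> w"
  have M: "M \<in> carrier_mat d d" "M\<^sup>T = M"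
    unfolding M_def by (rule value_moment_carrier, rule value_moment_symmetric[OF data])
  note eig = eigvals_symmetric[OF M]
  obtain i where i: "i < d" "x = eigvals M ! i"
    using x eig(2) unfolding M_def[symmetric] by (metis in_set_conv_nth)
  obtain U where U: "U \<in> carrier_mat d d" "U\<^sup>T * U = 1\<^sub>m d"
    and UMU: "U\<^sup>T * M * U = mat_diag d (\<lambda>i. eigvals M ! i)"
    using real_symmetric_spectral[OF M eig(1)] .
  \<comment> \<open>\<open>U * E\<close> keeps column \<open>i\<close> of \<open>U\<close> and
    replaces the other columns by zero.\<close>
  define E where "E = mat_diag d (\<lambda>j. if j = i then 1 else 0 :: real)"
  have E: "E \<in> carrier_mat d d" "E\<^sup>T = E" by (auto simp: E_def mat_diag_def)
  have "mat_trace (M * ((U * E) * (U * E)\<^sup>T)) = mat_trace ((M * (U * E)) * (U * E)\<^sup>T)"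
    using M(1) U(1) E(1) by (simp add: assoc_mult_mat[of _ d d _ d _ d])
  also have "\<dots> = mat_trace ((U * E)\<^sup>T * (M * (U * E)))"
    using M(1) U(1) E(1) by (intro mat_trace_mult_commute[of _ d d]) auto
  also have "(U * E)\<^sup>T * (M * (U * E)) = E * (U\<^sup>T * M * U) * E"
    using M(1) U(1) E by (simp add: transpose_mult[of _ d d _ d] assoc_mult_mat[of _ d d _ d _ d])
  also have "mat_trace \<dots> = (\<Sum>j<d. if j = i then eigvals M ! j else 0)"
    unfolding UMU E_def mat_diag_diag mat_trace_mat_diag by (rule sum.cong) auto
  also have "\<dots> = x" using i by simp
  finally have "x = mat_trace (M * ((U * E) * (U * E)\<^sup>T))" ..
  also have "\<dots> \<ge> 0"
    unfolding M_def mat_trace_value_moment[OF data mult_carrier_mat[OF U(1) E(1)]]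
    using data by (intro sum_nonneg mult_nonneg_nonneg) (auto simp: calibration_data_def)
  finally show ?thesis .
qed

text \<open>The general trace formula applies with \<open>X = 1\<^sub>m d - P * P\<^sup>T\<close>,
  for which \<open>X * X\<^sup>T = X\<close>.\<close>

lemma distortion_eq_trace:
  assumes data: "calibration_data d S H T V \<alpha> w" and P: "P \<in> orthonormal_cols d r"
  defines "M \<equiv> value_moment d S H V \<alpha> w"
  shows "distortion d S H V \<alpha> w P = mat_trace M - mat_trace (M * (P * P\<^sup>T))"
proof -
  have M: "M \<in> carrier_mat d d" unfolding M_def by (rule value_moment_carrier)
  define L where "L = P * P\<^sup>T"
  note L = orthonormal_cols_projector[OF P, folded L_def]
  let ?R = "1\<^sub>m d - L"
  have R: "?R \<in> carrier_mat d d" by (rule minus_carrier_mat[OF L(1)])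
  have "?R\<^sup>T = ?R" using L by (simp add: transpose_minus[of _ d d])
  moreover have "?R * ?R = ?R"
    using L R by (simp add: minus_mult_distrib_mat[of _ d d _ _ d] mult_minus_distrib_mat[of _ d d _ d])
      (auto intro!: eq_matI)
  ultimately have "distortion d S H V \<alpha> w P = mat_trace (M * ?R)"
    using mat_trace_value_moment[OF data R] unfolding distortion_def M_def L_def by simp
  also have "M * ?R = M - M * L"
    using M L by (simp add: mult_minus_distrib_mat[of _ d d _ d])
  also have "mat_trace \<dots> = mat_trace M - mat_trace (M * L)"
    using M L by (intro mat_trace_diff) auto
  finally show ?thesis unfolding L_def .
qed

text \<open>An upper bound on the captured trace is a lower bound on the rest of the trace, which is
  the full eigenvalue sum. The tail starts at \<open>r\<close> because positions in
  \<open>eigvals\<close> count from 0.\<close>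

lemma distortion_lower_bound:
  assumes data: "calibration_data d S H T V \<alpha> w" and r: "1 \<le> r" "r \<le> d"
    and P: "P \<in> orthonormal_cols d r"
  shows "(\<Sum>i=r..<d. eigvals (value_moment d S H V \<alpha> w) ! i) \<le> distortion d S H V \<alpha> w P"
proof -
  note M = value_moment_carrier value_moment_symmetric[OF data]
  show ?thesis
    using ky_fan_upper_bound[OF M r P] r
      sum.atLeastLessThan_concat[of 0 r d "\<lambda>i. eigvals (value_moment d S H V \<alpha> w) ! i"]
    unfolding distortion_eq_trace[OF data P] mat_trace_symmetric[OF M]
    by (simp add: atLeast0LessThan)
qed

section \<open>Column spaces, projectors and attainment of the bound\<close>

text \<open>Every column of \<open>P\<close> is a combination of columns of \<open>Q\<close>, so
  \<open>P = Q * R\<close> with \<open>R\<close> square. Orthonormality on both sides makes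
  \<open>R\<close> orthogonal, and \<open>R * R\<^sup>T\<close> cancels in the projector.\<close>

lemma col_space_eq_projector_eq:
  assumes P: "P \<in> orthonormal_cols d r" and Q: "Q \<in> orthonormal_cols d r"
    and sub: "vec_space.col_space d P = vec_space.col_space d Q"
  shows "P * P\<^sup>T = Q * Q\<^sup>T"
proof -
  interpret vec_space "TYPE(real)" d .
  note P = orthonormal_colsD[OF P] and Q = orthonormal_colsD[OF Q]
  have "\<exists>x\<in>carrier_vec r. Q *\<^sub>v x = col P j" if "j < r" for j
  proof -
    have "P *\<^sub>v unit_vec r j = col P j"
      using P(1) that by (intro eq_vecI) auto
    then have "col P j \<in> col_space P"
      unfolding col_space_eq[OF P(1)] using P that by (auto intro!: bexI[of _ "unit_vec r j"])
    then show ?thesis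
      unfolding sub col_space_eq[OF Q(1)] using Q by auto
  qed
  then obtain x where x: "\<And>j. j < r \<Longrightarrow> x j \<in> carrier_vec r \<and> Q *\<^sub>v x j = col P j" by metis
  define R where "R = mat_of_cols r (map x [0..<r])"
  have R: "R \<in> carrier_mat r r" unfolding R_def by (rule carrier_matI) simp_all
  have "col R j = x j" if "j < r" for j
    unfolding R_def using x that by (subst col_mat_of_cols) auto
  then have PQR: "P = Q * R"
    using P(1) Q(1) R x col_mult2[OF Q(1) R] by (intro mat_col_eqI) (auto simp del: col_mult2)
  have "R\<^sup>T * R = R\<^sup>T * (Q\<^sup>T * Q) * R" using Q(2) R by simp
  also have "\<dots> = P\<^sup>T * P"
    unfolding PQR using Q(1) R
    by (simp add: transpose_mult[of _ d r _ r] assoc_mult_mat[of _ r r _ d _ r]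
        assoc_mult_mat[of _ r d _ r _ r] assoc_mult_mat[of _ r r _ r _ r])
  finally have "R * R\<^sup>T = 1\<^sub>m r"
    using P(2) R by (intro orthogonal_mult_transpose) auto
  have "P * P\<^sup>T = Q * (R * R\<^sup>T) * Q\<^sup>T"
    unfolding PQR using Q(1) R
    by (simp add: transpose_mult[of _ d r _ r] assoc_mult_mat[of _ d r _ r _ d]
        assoc_mult_mat[of _ d r _ r _ r] assoc_mult_mat[of _ r r _ r _ d])
  with \<open>R * R\<^sup>T = 1\<^sub>m r\<close> Q(1) show ?thesis by simp
qed

lemma mat_of_cols_orthonormal:
  assumes "length us = r" "set us \<subseteq> carrier_vec d" "orthonormal_list us"
  shows "mat_of_cols d us \<in> orthonormal_cols d r"
proof -
  have "us ! i \<in> carrier_vec d" if "i < r" for i using assms that by auto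
  then have "(mat_of_cols d us)\<^sup>T * mat_of_cols d us = 1\<^sub>m r"
    using assms by (intro eq_matI) (auto simp: orthonormal_list_def)
  then show ?thesis using assms(1) by (auto simp: orthonormal_cols_def)
qed

text \<open>The columns of \<open>P\<close> need not be eigenvectors themselves. They span the same
  space as the eigenvectors \<open>us\<close>, so the projector may be computed from
  \<open>us\<close>, for which the captured trace is visibly the sum of the leading
  eigenvalues.\<close>

lemma distortion_top_eigenspace:
  assumes data: "calibration_data d S H T V \<alpha> w" and r: "r \<le> d"
    and P: "P \<in> orthonormal_cols d r"
    and top: "top_eigenspace d r (value_moment d S H V \<alpha> w) (vec_space.col_space d P)"
  shows "distortion d S H V \<alpha> w P = (\<Sum>i=r..<d. eigvals (value_moment d S H V \<alpha> w) ! i)"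
proof -
  interpret vec_space "TYPE(real)" d .
  define M where "M = value_moment d S H V \<alpha> w"
  have M: "M \<in> carrier_mat d d" "M\<^sup>T = M"
    unfolding M_def by (rule value_moment_carrier, rule value_moment_symmetric[OF data])
  obtain us where us: "length us = r" "orthonormal_list us"
    and ev: "\<And>i. i < r \<Longrightarrow> eigenvector M (us ! i) (eigvals M ! i)"
    and span: "col_space P = span (set us)"
    using top unfolding top_eigenspace_def M_def by auto
  have usc: "us ! i \<in> carrier_vec d" and Mus: "M *\<^sub>v (us ! i) = eigvals M ! i \<cdot>\<^sub>v us ! i" if "i < r" for i
    using ev[OF that] M by (auto simp: eigenvector_def)
  have sub: "set us \<subseteq> carrier_vec d" using usc us(1) by (auto simp: in_set_conv_nth)
  define U where "U = mat_of_cols d us"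
  have U: "U \<in> orthonormal_cols d r"
    unfolding U_def by (rule mat_of_cols_orthonormal[OF us(1) sub us(2)])
  note Uc = orthonormal_colsD(1)[OF U]
  have "col_space U = span (set us)"
    unfolding U_def col_space_def using sub by simp
  then have "col_space P = col_space U" unfolding span ..
  then have PU: "P * P\<^sup>T = U * U\<^sup>T"
    by (rule col_space_eq_projector_eq[OF P U])
  have MU: "col (M * U) i = eigvals M ! i \<cdot>\<^sub>v us ! i" and Ui: "col U i = us ! i" if "i < r" for i
    using that usc us(1) Mus[OF that] col_mult2[OF M(1) Uc that] by (auto simp: U_def simp del: col_mult2)
  have "mat_trace (M * (U * U\<^sup>T)) = mat_trace ((M * U) * U\<^sup>T)"
    using M Uc by (simp add: assoc_mult_mat[of _ d d _ r _ d])
  also have "\<dots> = mat_trace (U\<^sup>T * (M * U))"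
    using M Uc by (intro mat_trace_mult_commute[of _ d r]) auto
  also have "\<dots> = (\<Sum>i<r. eigvals M ! i)"
  proof -
    have "(U\<^sup>T * (M * U)) $$ (i, i) = eigvals M ! i" if i: "i < r" for i
    proof -
      have "(U\<^sup>T * (M * U)) $$ (i, i) = col U i \<bullet> col (M * U) i"
        using Uc M i by (simp del: col_mult2)
      also have "\<dots> = eigvals M ! i * (us ! i \<bullet> us ! i)"
        unfolding MU[OF i] Ui[OF i] using usc[OF i] by simp
      finally show ?thesis using us i by (simp add: orthonormal_list_def)
    qed
    then show ?thesis using Uc by (simp add: mat_trace_def)
  qed
  finally have "distortion d S H V \<alpha> w P = (\<Sum>i<d. eigvals M ! i) - (\<Sum>i<r. eigvals M ! i)"
    unfolding distortion_eq_trace[OF data P] M_def[symmetric] PU mat_trace_symmetric[OF M] by simp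
  then show ?thesis
    using sum.atLeastLessThan_concat[of 0 r d "\<lambda>i. eigvals M ! i"] r
    unfolding M_def[symmetric] by (simp add: atLeast0LessThan)
qed

text \<open>The first \<open>r\<close> columns of a diagonalising orthogonal matrix serve, since its
  diagonal follows the decreasing order of \<open>eigvals\<close>. This provides a
  minimizer.\<close>

lemma top_eigenspace_exists:
  fixes M :: "real mat"
  assumes M: "M \<in> carrier_mat d d" "M\<^sup>T = M" and r: "r \<le> d"
  obtains P where "P \<in> orthonormal_cols d r" "top_eigenspace d r M (vec_space.col_space d P)"
proof -
  interpret vec_space "TYPE(real)" d .
  obtain U where U: "U \<in> carrier_mat d d" "U\<^sup>T * U = 1\<^sub>m d"
    and UMU: "U\<^sup>T * M * U = mat_diag d (\<lambda>i. eigvals M ! i)"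
    using real_symmetric_spectral[OF M eigvals_symmetric(1)[OF M]] .
  \<comment> \<open>Undoing the left factor of the diagonalisation yields the eigenvector equations,
    one per column of \<open>U\<close>.\<close>
  have "U * (U\<^sup>T * (M * U)) = (U * U\<^sup>T) * (M * U)"
    using U(1) M(1) by (intro assoc_mult_mat[symmetric]) auto
  then have "M * U = U * (U\<^sup>T * M * U)"
    using U(1) orthogonal_mult_transpose[OF U] M(1) by (simp add: assoc_mult_mat[of _ d d _ d _ d])
  then have MU: "M * U = U * mat_diag d (\<lambda>i. eigvals M ! i)" unfolding UMU .
  define us where "us = map (col U) [0..<r]"
  have len: "length us = r" by (simp add: us_def)
  have nth: "us ! i = col U i" if "i < r" for i using that by (simp add: us_def)
  have sub: "set us \<subseteq> carrier_vec d" using U by (auto simp: us_def)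
  have dot: "col U i \<bullet> col U j = (if i = j then 1 else 0)" if "i < d" "j < d" for i j
    using arg_cong[OF U(2), of "\<lambda>X. X $$ (i, j)"] that U(1) by simp
  then have on: "orthonormal_list us"
    using r by (simp add: orthonormal_list_def len nth)
  have "eigenvector M (us ! i) (eigvals M ! i)" if i: "i < r" for i
  proof -
    have id: "i < d" using i r by simp
    have "M *\<^sub>v col U i = col (U * mat_diag d (\<lambda>i. eigvals M ! i)) i"
      using MU col_mult2[OF M(1) U(1) id] by simp
    also have "\<dots> = eigvals M ! i \<cdot>\<^sub>v col U i"
      unfolding mat_diag_mult_right[OF U(1)] using U(1) id by (intro eq_vecI) (auto simp: mult.commute)
    finally have "M *\<^sub>v col U i = eigvals M ! i \<cdot>\<^sub>v col U i" .
    moreover have "col U i \<noteq> 0\<^sub>v d" using dot[OF id id] by auto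
    ultimately show ?thesis
      using M U id i by (simp add: eigenvector_def nth)
  qed
  then have "top_eigenspace d r M (col_space (mat_of_cols d us))"
    unfolding top_eigenspace_def col_space_def using len on sub by auto
  then show ?thesis
    using that mat_of_cols_orthonormal[OF len sub on] by blast
qed

lemma is_arg_min_distortion:
  assumes data: "calibration_data d S H T V \<alpha> w" and r: "1 \<le> r" "r \<le> d"
    and P: "P \<in> orthonormal_cols d r"
    and top: "top_eigenspace d r (value_moment d S H V \<alpha> w) (vec_space.col_space d P)"
  shows "is_arg_min (distortion d S H V \<alpha> w) (\<lambda>Q. Q \<in> orthonormal_cols d r) P"
  using P distortion_lower_bound[OF data r]
  unfolding is_arg_min_def distortion_top_eigenspace[OF data r(2) P top] by (auto simp: not_less)

section \<open>An instance with ties\<close>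

lemma value_moment_unit:
  "value_moment d {s} (\<lambda>_. {h}) (\<lambda>_. 1\<^sub>m d) (\<lambda>_ _. 1\<^sub>m d) (\<lambda>_ _. 1) = 1\<^sub>m d"
  by (rule eq_matI) (auto simp: value_moment_def)

lemma calibration_data_unit:
  "calibration_data d {s} (\<lambda>_. {h}) (\<lambda>_. d) (\<lambda>_. 1\<^sub>m d) (\<lambda>_ _. 1\<^sub>m d) (\<lambda>_ _. 1)"
  by (simp add: calibration_data_def)

text \<open>All projectors of rank \<open>r\<close> have the same trace, so on this instance the
  objective is constant and every feasible \<open>P\<close> is optimal.\<close>

lemma distortion_unit:
  assumes "P \<in> orthonormal_cols d r"
  shows "distortion d {s} (\<lambda>_. {h}) (\<lambda>_. 1\<^sub>m d) (\<lambda>_ _. 1\<^sub>m d) (\<lambda>_ _. 1) P = real d - real r"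
  using orthonormal_cols_projector(4)[OF assms]
    left_mult_one_mat[OF orthonormal_cols_projector(1)[OF assms]]
    distortion_eq_trace[OF calibration_data_unit assms, of s h]
  by (simp add: value_moment_unit mat_trace_one)

text \<open>The only possible eigenvalue is 1, while the list has length \<open>d\<close>, which is
  at least 2.\<close>

lemma eigvals_one_not_distinct:
  assumes "2 \<le> d"
  shows "\<not> distinct (eigvals (1\<^sub>m d))"
proof -
  have "set (eigvals (1\<^sub>m d)) \<subseteq> {1}"
  proof
    fix x assume "x \<in> set (eigvals (1\<^sub>m d))"
    then have "poly (char_poly (1\<^sub>m d)) x = 0"
      using degree_monic_char_poly[of "1\<^sub>m d :: real mat" d]
      by (cases "char_poly (1\<^sub>m d :: real mat) = 0") (auto simp: eigvals_def)
    then have "eigenvalue (1\<^sub>m d) x"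
      using eigenvalue_root_char_poly[of "1\<^sub>m d" d x] by simp
    then obtain v where v: "v \<in> carrier_vec d" "v \<noteq> 0\<^sub>v d" "v = x \<cdot>\<^sub>v v"
      unfolding eigenvalue_def eigenvector_def by auto
    then obtain i where "i < d" "v $ i \<noteq> 0" by (metis carrier_vecD eq_vecI index_zero_vec)
    with arg_cong[OF v(3), of "\<lambda>u. u $ i"] v(1) show "x \<in> {1}" by simp
  qed
  then have "card (set (eigvals (1\<^sub>m d))) \<le> 1"
    using card_mono[of "{1 :: real}"] by simp
  moreover have "length (eigvals (1\<^sub>m d)) = d"
    by (rule eigvals_symmetric) auto
  ultimately show ?thesis
    using assms distinct_card[of "eigvals (1\<^sub>m d)"] by linarith
qed

lemma unit_vec_orthonormal_cols:
  assumes "i < d"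
  shows "mat_of_cols d [unit_vec d i] \<in> orthonormal_cols d 1"
  using assms by (intro mat_of_cols_orthonormal) (auto simp: orthonormal_list_def)

text \<open>The existence of a feasible \<open>P\<close> spanning a top eigenspace is asserted
  explicitly, so that the optimality clause is not vacuous.\<close>

theorem theorem1:
  shows
    "(\<forall>d r (S :: 's set) (H :: 's \<Rightarrow> 'h set) T V \<alpha> w.
        1 \<le> d \<longrightarrow> 1 \<le> r \<longrightarrow> r \<le> d \<longrightarrow> calibration_data d S H T V \<alpha> w \<longrightarrow>
        (let D = distortion d S H V \<alpha> w;
             M = value_moment d S H V \<alpha> w;
             lam = eigvals M
         in length lam = d \<and> sorted_wrt (\<ge>) lam \<and> (\<forall>x\<in>set lam. 0 \<le> x) \<and>
            (\<exists>P\<in>orthonormal_cols d r. top_eigenspace d r M (vec_space.col_space d P)) \<and>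
            (\<forall>P\<in>orthonormal_cols d r. top_eigenspace d r M (vec_space.col_space d P) \<longrightarrow>
               is_arg_min D (\<lambda>Q. Q \<in> orthonormal_cols d r) P) \<and>
            (\<exists>P. is_arg_min D (\<lambda>Q. Q \<in> orthonormal_cols d r) P \<and>
               D P = (\<Sum>i=r..<d. lam ! i))))
     \<and>
     (\<exists>d r (S :: 's set) (H :: 's \<Rightarrow> 'h set) T V \<alpha> w.
        1 \<le> d \<and> 1 \<le> r \<and> r \<le> d \<and> calibration_data d S H T V \<alpha> w \<and>
        \<not> distinct (eigvals (value_moment d S H V \<alpha> w)) \<and>
        (\<exists>P Q. is_arg_min (distortion d S H V \<alpha> w) (\<lambda>P. P \<in> orthonormal_cols d r) P \<and>
               is_arg_min (distortion d S H V \<alpha> w) (\<lambda>P. P \<in> orthonormal_cols d r) Q \<and>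
               P * P\<^sup>T \<noteq> Q * Q\<^sup>T))"
proof (intro conjI allI impI, goal_cases)
  case (1 d r S H T V \<alpha> w)
  note r = 1(2,3) and data = 1(4)
  note M = value_moment_carrier value_moment_symmetric[OF data]
  obtain P where P: "P \<in> orthonormal_cols d r"
    "top_eigenspace d r (value_moment d S H V \<alpha> w) (vec_space.col_space d P)"
    using top_eigenspace_exists[OF M r(2)] .
  show ?case
    unfolding Let_def
  proof (intro conjI ballI impI)
    show "\<exists>P\<in>orthonormal_cols d r.
        top_eigenspace d r (value_moment d S H V \<alpha> w) (vec_space.col_space d P)"
      using P by blast
    show "\<exists>P. is_arg_min (distortion d S H V \<alpha> w) (\<lambda>Q. Q \<in> orthonormal_cols d r) P \<and>
        distortion d S H V \<alpha> w P = (\<Sum>i=r..<d. eigvals (value_moment d S H V \<alpha> w) ! i)"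
      using is_arg_min_distortion[OF data r P] distortion_top_eigenspace[OF data r(2) P] by blast
  qed (use eigvals_symmetric(2)[OF M] sorted_wrt_eigvals eigvals_value_moment_nonneg[OF data]
      is_arg_min_distortion[OF data r] in auto)
next
  case 2
  \<comment> \<open>Every type is inhabited, so \<open>undefined\<close> provides one sequence and
    one head for arbitrary index types.\<close>
  let ?D = "distortion 2 {undefined :: 's} (\<lambda>_. {undefined :: 'h}) (\<lambda>_. 1\<^sub>m 2) (\<lambda>_ _. 1\<^sub>m 2) (\<lambda>_ _. 1)"
  let ?P = "mat_of_cols 2 [unit_vec 2 0] :: real mat" and ?Q = "mat_of_cols 2 [unit_vec 2 1] :: real mat"
  have min: "is_arg_min ?D (\<lambda>P. P \<in> orthonormal_cols 2 1) P" if "P \<in> orthonormal_cols 2 1" for P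
    using that by (auto simp: is_arg_min_def distortion_unit)
  \<comment> \<open>The top left entry separates the projectors onto the two coordinate
    axes.\<close>
  have "(?P * ?P\<^sup>T) $$ (0, 0) = 1" "(?Q * ?Q\<^sup>T) $$ (0, 0) = 0"
    by (simp_all add: scalar_prod_def mat_of_cols_def)
  then have "?P * ?P\<^sup>T \<noteq> ?Q * ?Q\<^sup>T" by (metis zero_neq_one)
  then have ex: "\<exists>P Q. is_arg_min ?D (\<lambda>P. P \<in> orthonormal_cols 2 1) P \<and>
      is_arg_min ?D (\<lambda>P. P \<in> orthonormal_cols 2 1) Q \<and> P * P\<^sup>T \<noteq> Q * Q\<^sup>T"
    using min[OF unit_vec_orthonormal_cols[of 0 2]] min[OF unit_vec_orthonormal_cols[of 1 2]]
    by auto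
  show ?case
    by (rule exI[of _ 2], rule exI[of _ 1], rule exI[of _ "{undefined}"],
        rule exI[of _ "\<lambda>_. {undefined}"], rule exI[of _ "\<lambda>_. 2"], rule exI[of _ "\<lambda>_. 1\<^sub>m 2"],
        rule exI[of _ "\<lambda>_ _. 1\<^sub>m 2"], rule exI[of _ "\<lambda>_ _. 1"])
      (use ex calibration_data_unit eigvals_one_not_distinct[of 2] in \<open>simp add: value_moment_unit\<close>)
qed

end
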